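(* Let $\ell_2$ be a discrete target loss function. Assume that the hypothesis set $\mathcal{H}$ satisfies, for any $x\in\mathcal{X}$, $\mathsf{H}(x)=\mathcal{Y}$, where $\mathsf{H}(x)=\{\mathsf{h}(x)\colon h\in\mathcal{H}\}$. Then $\mathcal{I}_{\ell_2}(\mathcal{H})=0$ and $\mathcal{M}_{\ell_2}(\mathcal{H})=\mathcal{A}_{\ell_2}(\mathcal{H})$.
   Context: Multi-class classification: input space $\mathcal{X}$, label space $\mathcal{Y}=\{1,\ldots,n\}$, $\mathcal{D}$ a distribution over $\mathcal{X}\times\mathcal{Y}$. $\mathcal{H}_{\rm all}$ is the family of all real-valued measurable functions on $\mathcal{X}\times\mathcal{Y}$ and $\mathcal{H}\subseteq\mathcal{H}_{\rm all}$. The label predicted by $h$ at $x$ is $\mathsf{h}(x)=\operatorname{argmax}_{y\in\mathcal{Y}}h(x,y)$, ties broken by selecting the highest index. A loss $\ell_2$ is discrete if $\ell_2(h,x,y)=\mathsf{L}(\mathsf{h}(x),y)$ for some function $\mathsf{L}\colon\mathcal{Y}\times\mathcal{Y}\to\mathbb{R}_+$. With $p(x,y)=\mathcal{D}(Y=y\mid X=x)$, for a loss $\ell$ and a hypothesis set $\mathcal{G}$ (either $\mathcal{H}$ or $\mathcal{H}_{\rm all}$): $\mathcal{E}_\ell(h)=\mathbb{E}_{(x,y)\sim\mathcal{D}}[\ell(h,x,y)]$, $\mathcal{E}^*_\ell(\mathcal{G})=\inf_{h\in\mathcal{G}}\mathcal{E}_\ell(h)$, $\mathcal{C}_\ell(h,x)=\sum_y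 p(x,y)\ell(h,x,y)$, $\mathcal{C}^*_\ell(\mathcal{G},x)=\inf_{h\in\mathcal{G}}\mathcal{C}_\ell(h,x)$. Minimizability gap: $\mathcal{M}_\ell(\mathcal{H})=\mathcal{E}^*_\ell(\mathcal{H})-\mathbb{E}_x[\mathcal{C}^*_\ell(\mathcal{H},x)]$. Approximation error: $\mathcal{A}_\ell(\mathcal{H})=\mathcal{E}^*_\ell(\mathcal{H})-\mathcal{E}^*_\ell(\mathcal{H}_{\rm all})$. Difference of pointwise infima: $\mathcal{I}_\ell(\mathcal{H})=\mathbb{E}_x[\mathcal{C}^*_\ell(\mathcal{H},x)-\mathcal{C}^*_\ell(\mathcal{H}_{\rm all},x)]$. *)

theory Defs
  imports "HOL-Probability.Probability"
begin

text \<open>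
  The input space is \<open>space M\<close> for a measurable space \<open>M\<close>; the label space is \<open>{1..n}\<close> with the
  discrete sigma-algebra. Hypotheses and losses are total HOL functions, so all conditions on them
  are relativised to \<open>space M\<close> and \<open>{1..n}\<close>.
\<close>

type_synonym 'a hypothesis = "'a \<Rightarrow> nat \<Rightarrow> real"
type_synonym 'a loss = "'a hypothesis \<Rightarrow> 'a \<Rightarrow> nat \<Rightarrow> real"

definition example_space :: "'a measure \<Rightarrow> nat \<Rightarrow> ('a \<times> nat) measure" where
  "example_space M n = M \<Otimes>\<^sub>M count_space {1..n}"

definition all_hypotheses :: "'a measure \<Rightarrow> nat \<Rightarrow> 'a hypothesis set" where
  "all_hypotheses M n = {h. case_prod h \<in> borel_measurable (example_space M n)}"

text \<open>The maximum implements the tie-breaking rule in favour of the highest index.\<close>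

definition predicted_label :: "nat \<Rightarrow> 'a hypothesis \<Rightarrow> 'a \<Rightarrow> nat" where
  "predicted_label n h x = Max {y. is_arg_max (h x) (\<lambda>y. y \<in> {1..n}) y}"

definition predicted_labels :: "nat \<Rightarrow> 'a hypothesis set \<Rightarrow> 'a \<Rightarrow> nat set" where
  "predicted_labels n H x = {predicted_label n h x | h. h \<in> H}"

definition discrete_loss :: "'a measure \<Rightarrow> nat \<Rightarrow> 'a loss \<Rightarrow> bool" where
  "discrete_loss M n l \<longleftrightarrow>
    (\<exists>L :: nat \<Rightarrow> nat \<Rightarrow> real.
      (\<forall>k\<in>{1..n}. \<forall>y\<in>{1..n}. 0 \<le> L k y) \<and>
      (\<forall>h\<in>all_hypotheses M n. \<forall>x\<in>space M. \<forall>y\<in>{1..n}. l h x y = L (predicted_label n h x) y))"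

definition input_marginal :: "'a measure \<Rightarrow> ('a \<times> nat) measure \<Rightarrow> 'a measure" where
  "input_marginal M D = distr D M fst"

text \<open>
  \<open>p x y\<close> is a version of the conditional probability of label \<open>y\<close> given input \<open>x\<close>, i.e. a regular
  conditional distribution of the label given the input.
\<close>

definition label_cond_prob ::
  "'a measure \<Rightarrow> nat \<Rightarrow> ('a \<times> nat) measure \<Rightarrow> ('a \<Rightarrow> nat \<Rightarrow> real) \<Rightarrow> bool" where
  "label_cond_prob M n D p \<longleftrightarrow>
    (\<forall>y\<in>{1..n}. (\<lambda>x. p x y) \<in> borel_measurable M) \<and>
    (\<forall>x\<in>space M. (\<forall>y\<in>{1..n}. 0 \<le> p x y) \<and> (\<Sum>y\<in>{1..n}. p x y) = 1) \<and>
    (\<forall>A\<in>sets M. \<forall>y\<in>{1..n}. measure D (A \<times> {y}) = (LINT x:A|input_marginal M D. p x y))"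

text \<open>
  Errors are Bochner integrals and infima are taken in the reals. A discrete loss takes finitely
  many nonnegative values, so for such losses these integrals and infima (over nonempty sets of
  measurable hypotheses) never take default values.
\<close>

definition gen_error :: "('a \<times> nat) measure \<Rightarrow> 'a loss \<Rightarrow> 'a hypothesis \<Rightarrow> real" where
  "gen_error D l h = (LINT (x, y)|D. l h x y)"

definition best_error :: "('a \<times> nat) measure \<Rightarrow> 'a loss \<Rightarrow> 'a hypothesis set \<Rightarrow> real" where
  "best_error D l G = (INF h\<in>G. gen_error D l h)"

definition cond_error ::
  "nat \<Rightarrow> ('a \<Rightarrow> nat \<Rightarrow> real) \<Rightarrow> 'a loss \<Rightarrow> 'a hypothesis \<Rightarrow> 'a \<Rightarrow> real" where
  "cond_error n p l h x = (\<Sum>y\<in>{1..n}. p x y * l h x y)"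

definition best_cond_error ::
  "nat \<Rightarrow> ('a \<Rightarrow> nat \<Rightarrow> real) \<Rightarrow> 'a loss \<Rightarrow> 'a hypothesis set \<Rightarrow> 'a \<Rightarrow> real" where
  "best_cond_error n p l G x = (INF h\<in>G. cond_error n p l h x)"

definition minimizability_gap ::
  "'a measure \<Rightarrow> nat \<Rightarrow> ('a \<times> nat) measure \<Rightarrow> ('a \<Rightarrow> nat \<Rightarrow> real) \<Rightarrow> 'a loss \<Rightarrow> 'a hypothesis set \<Rightarrow> real" where
  "minimizability_gap M n D p l H =
    best_error D l H - (LINT x|input_marginal M D. best_cond_error n p l H x)"

definition approximation_error ::
  "'a measure \<Rightarrow> nat \<Rightarrow> ('a \<times> nat) measure \<Rightarrow> 'a loss \<Rightarrow> 'a hypothesis set \<Rightarrow> real" where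
  "approximation_error M n D l H = best_error D l H - best_error D l (all_hypotheses M n)"

definition pointwise_infima_diff ::
  "'a measure \<Rightarrow> nat \<Rightarrow> ('a \<times> nat) measure \<Rightarrow> ('a \<Rightarrow> nat \<Rightarrow> real) \<Rightarrow> 'a loss \<Rightarrow> 'a hypothesis set \<Rightarrow> real" where
  "pointwise_infima_diff M n D p l H =
    (LINT x|input_marginal M D.
      best_cond_error n p l H x - best_cond_error n p l (all_hypotheses M n) x)"

end

theory Submission
  imports Defs
begin

text \<open>
  The conditional error of a discrete loss at \<open>x\<close> depends on the hypothesis only through the label
  predicted at \<open>x\<close>. Both families realise every label at every \<open>x\<close>, so their pointwise infima are the
  same minimum over labels. For all measurable hypotheses this minimum is attained at every \<open>x\<close>
  simultaneously, by the hypothesis scoring a label by minus its conditional cost; integrating over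
  \<open>x\<close> then identifies the best error with the expected pointwise infimum.
\<close>

section \<open>Predicted labels as maximisers, and conditional costs of labels\<close>

definition label_cost :: "nat \<Rightarrow> ('a \<Rightarrow> nat \<Rightarrow> real) \<Rightarrow> (nat \<Rightarrow> nat \<Rightarrow> real) \<Rightarrow> 'a \<Rightarrow> nat \<Rightarrow> real" where
  "label_cost n p L x k = (\<Sum>y\<in>{1..n}. p x y * L k y)"

text \<open>\<open>Max\<close> is only meaningful on a finite nonempty set. The maximisers lie in
  \<open>{1..n}\<close>, and for \<open>n\<close> positive the largest score is attained, so the
  \<open>Max\<close> of the maximisers is itself a maximiser.\<close>

lemma predicted_label_is_arg_max:
  assumes "1 \<le> n"
  shows "is_arg_max (h x) (\<lambda>y. y \<in> {1..n}) (predicted_label n h x)"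
proof -
  let ?S = "{y. is_arg_max (h x) (\<lambda>y. y \<in> {1..n}) y}"
  have "finite ?S"
    by (rule finite_subset[of _ "{1..n}"]) (auto simp: is_arg_max_def)
  moreover have "?S \<noteq> {}"
  proof -
    have "Max (h x ` {1..n}) \<in> h x ` {1..n}"
      using assms by (intro Max_in) auto
    then obtain k where k: "k \<in> {1..n}" "Max (h x ` {1..n}) = h x k"
      by auto
    have "h x y \<le> h x k" if "y \<in> {1..n}" for y
      unfolding k(2)[symmetric] using that by (intro Max_ge) auto
    with k(1) have "k \<in> ?S"
      by (auto simp: is_arg_max_def not_less)
    then show ?thesis by blast
  qed
  ultimately have "Max ?S \<in> ?S"
    by (rule Max_in)
  then show ?thesis
    by (simp add: predicted_label_def)
qed

lemma predicted_label_in: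
  assumes "1 \<le> n"
  shows "predicted_label n h x \<in> {1..n}"
  using predicted_label_is_arg_max[OF assms, of h x] by (simp only: is_arg_max_def)

lemma predicted_label_ge:
  assumes "y \<in> {1..n}"
  shows "h x y \<le> h x (predicted_label n h x)"
  using predicted_label_is_arg_max[of n h x] assms by (auto simp: is_arg_max_def not_less)

section \<open>Measurability of hypotheses and of predicted labels\<close>

lemma all_hypotheses_section_measurable:
  assumes "h \<in> all_hypotheses M n" "y \<in> {1..n}"
  shows "(\<lambda>x. h x y) \<in> borel_measurable M"
proof -
  have h: "case_prod h \<in> borel_measurable (M \<Otimes>\<^sub>M count_space {1..n})"
    using assms(1) by (simp add: all_hypotheses_def example_space_def)
  have "(\<lambda>x. (x, y)) \<in> measurable M (M \<Otimes>\<^sub>M count_space {1..n})"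
    by (rule measurable_Pair2') (simp only: space_count_space assms(2))
  from measurable_compose[OF this h] show ?thesis by simp
qed

text \<open>Because there are finitely many labels, a jointly measurable function can be glued from
  measurable sections, selecting the section by the second coordinate.\<close>

lemma all_hypothesesI:
  assumes "\<And>y. y \<in> {1..n} \<Longrightarrow> (\<lambda>x. h x y) \<in> borel_measurable M"
  shows "h \<in> all_hypotheses M n"
proof -
  have "(\<lambda>z. h (fst z) (snd z)) \<in> borel_measurable (M \<Otimes>\<^sub>M count_space {1..n})"
  proof (rule measurable_compose_countable'[where I = "{1..n}" and f = "\<lambda>k z. h (fst z) k"])
    show "(\<lambda>z. h (fst z) k) \<in> borel_measurable (M \<Otimes>\<^sub>M count_space {1..n})"
      if "k \<in> {1..n}" for k
      by (rule measurable_compose[OF measurable_fst assms[OF that]])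
  qed (simp_all only: measurable_snd countable_finite finite_atLeastAtMost)
  then show ?thesis
    by (simp add: all_hypotheses_def example_space_def case_prod_unfold)
qed

text \<open>That \<open>y\<close> is a maximiser is a finite conjunction of comparisons between
  measurable sections, and the maximum of a set of naturals with measurable membership is
  measurable. This makes the regions of constant prediction measurable, so that conditional
  probabilities can be integrated over them.\<close>

lemma predicted_label_measurable:
  assumes "h \<in> all_hypotheses M n"
  shows "predicted_label n h \<in> measurable M (count_space UNIV)"
proof -
  \<comment> \<open>Membership has to be measurable for every natural number; outside
    \<open>{1..n}\<close> it is constantly false.\<close>
  have *: "(\<lambda>x. is_arg_max (h x) (\<lambda>y. y \<in> {1..n}) y) \<in> measurable M (count_space UNIV)" for y
  proof (cases "y \<in> {1..n}")
    case True
    have [measurable]: "(\<lambda>x. h x y) \<in> borel_measurable M"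
      by (rule all_hypotheses_section_measurable[OF assms True])
    have "Measurable.pred M (\<lambda>x. \<forall>z\<in>{1..n}. h x z \<le> h x y)"
    proof (rule pred_intros_finite)
      fix z assume "z \<in> {1..n}"
      then have [measurable]: "(\<lambda>x. h x z) \<in> borel_measurable M"
        by (rule all_hypotheses_section_measurable[OF assms])
      show "Measurable.pred M (\<lambda>x. h x z \<le> h x y)" by measurable
    qed simp
    moreover have "(\<lambda>x. is_arg_max (h x) (\<lambda>y. y \<in> {1..n}) y) = (\<lambda>x. \<forall>z\<in>{1..n}. h x z \<le> h x y)"
      using True by (auto simp: is_arg_max_def fun_eq_iff not_less)
    ultimately show ?thesis by simp
  next
    case False
    then have "(\<lambda>x. is_arg_max (h x) (\<lambda>y. y \<in> {1..n}) y) = (\<lambda>x. False)"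
      by (auto simp: is_arg_max_def fun_eq_iff)
    then show ?thesis by simp
  qed
  show ?thesis
    unfolding predicted_label_def[abs_def]
    by (rule measurable_Max_nat) (rule *)
qed

text \<open>Turns an infimum over hypotheses into one over labels: \<open>G\<close> enters only
  through the labels it realises at \<open>x\<close>.\<close>

lemma best_cond_error_eq:
  assumes "\<And>h. h \<in> G \<Longrightarrow> cond_error n p l h x = label_cost n p L x (predicted_label n h x)"
  shows "best_cond_error n p l G x = Inf (label_cost n p L x ` predicted_labels n G x)"
proof -
  have "(\<lambda>h. cond_error n p l h x) ` G = label_cost n p L x ` predicted_labels n G x"
    using assms by (force simp: predicted_labels_def)
  then show ?thesis
    by (simp add: best_cond_error_def)
qed

section \<open>Errors as integrals of conditional costs\<close>

locale labelled_distribution = prob_space D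
  for M :: "'a measure" and n :: nat and D :: "('a \<times> nat) measure" and p :: "'a \<Rightarrow> nat \<Rightarrow> real" +
  assumes sets_D: "sets D = sets (example_space M n)"
    and cond_prob: "label_cond_prob M n D p"
begin

abbreviation "marg \<equiv> input_marginal M D"

lemma sets_D_pair: "sets D = sets (M \<Otimes>\<^sub>M count_space {1..n})"
  using sets_D by (simp only: example_space_def)

lemma space_D: "space D = space M \<times> {1..n}"
  using sets_eq_imp_space_eq[OF sets_D_pair] by (simp add: space_pair_measure)

text \<open>With no labels the space of \<open>D\<close> would be empty, which a probability measure
  excludes.\<close>

lemma n_pos: "1 \<le> n"
  using not_empty by (cases n) (auto simp: space_D)

lemma fst_measurable: "fst \<in> measurable D M"
  unfolding measurable_cong_sets[OF sets_D_pair refl] by (rule measurable_fst)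

lemma prob_space_marg: "prob_space marg"
  unfolding input_marginal_def by (rule prob_space_distr[OF fst_measurable])

lemma space_marg: "space marg = space M" and sets_marg: "sets marg = sets M"
  by (simp_all add: input_marginal_def)

lemma p_integrable:
  assumes "y \<in> {1..n}"
  shows "integrable marg (\<lambda>x. p x y)"
proof -
  interpret marg: prob_space marg by (rule prob_space_marg)
  have "\<bar>p x y\<bar> \<le> 1" if "x \<in> space M" for x
  proof -
    have "\<forall>z\<in>{1..n}. 0 \<le> p x z" "(\<Sum>z\<in>{1..n}. p x z) = 1"
      using cond_prob that by (auto simp: label_cond_prob_def)
    with assms member_le_sum[of y "{1..n}" "p x"] show ?thesis by auto
  qed
  moreover have "(\<lambda>x. p x y) \<in> borel_measurable marg"
    using cond_prob assms
    by (auto simp: label_cond_prob_def measurable_cong_sets[OF sets_marg refl])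
  ultimately show ?thesis
    by (intro marg.integrable_const_bound[where B = 1] AE_I2) (auto simp: space_marg)
qed

text \<open>Disintegration for a classifier \<open>g\<close>: finitely many labels make the loss a
  finite combination of indicators of measurable rectangles, and on rectangles the identity is the
  defining property of \<open>p\<close>.\<close>

lemma
  assumes g: "g \<in> measurable M (count_space UNIV)"
    and g_in: "\<And>x. x \<in> space M \<Longrightarrow> g x \<in> {1..n}"
  shows integrable_label_cost: "integrable marg (\<lambda>x. label_cost n p L x (g x))" (is ?int)
    and integral_label_cost:
      "(LINT (x, y)|D. L (g x) y) = (LINT x|marg. label_cost n p L x (g x))" (is ?eq)
proof -
  \<comment> \<open>The level sets of \<open>g\<close> partition \<open>space M\<close>, so in the
    sums below only the term with \<open>k = g x\<close> survives at \<open>x\<close>.\<close>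
  define A where "A k = g -` {k} \<inter> space M" for k
  have A: "A k \<in> sets M" for k
    unfolding A_def by (rule measurable_sets[OF g]) simp
  have int: "integrable marg (\<lambda>x. indicator (A k) x * p x y)" if "y \<in> {1..n}" for k y
    using integrable_mult_indicator[OF _ p_integrable[OF that], of "A k"] A sets_marg by simp
  have AD: "A k \<times> {y} \<in> sets D" if "y \<in> {1..n}" for k y
    unfolding sets_D_pair using A that by (intro pair_measureI) auto
  have cost: "label_cost n p L x (g x) =
      (\<Sum>k\<in>{1..n}. \<Sum>y\<in>{1..n}. L k y * (indicator (A k) x * p x y))" if x: "x \<in> space M" for x
  proof -
    have "(\<Sum>k\<in>{1..n}. \<Sum>y\<in>{1..n}. L k y * (indicator (A k) x * p x y)) =
        (\<Sum>k\<in>{1..n}. if g x = k then label_cost n p L x k else 0)"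
      using x by (intro sum.cong) (auto simp: A_def label_cost_def mult.commute)
    also have "\<dots> = label_cost n p L x (g x)"
      using g_in[OF x] by simp
    finally show ?thesis by simp
  qed
  have "integrable marg (\<lambda>x. \<Sum>k\<in>{1..n}. \<Sum>y\<in>{1..n}. L k y * (indicator (A k) x * p x y))"
    by (intro Bochner_Integration.integrable_sum integrable_mult_right int)
  then show ?int
    by (subst Bochner_Integration.integrable_cong[OF refl cost]) (simp_all add: space_marg)
  have loss: "L (g x) y = (\<Sum>k\<in>{1..n}. \<Sum>y'\<in>{1..n}. L k y' * indicator (A k \<times> {y'}) (x, y))"
    if x: "x \<in> space M" "y \<in> {1..n}" for x y
  proof -
    have "(\<Sum>k\<in>{1..n}. \<Sum>y'\<in>{1..n}. L k y' * indicator (A k \<times> {y'}) (x, y)) =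
        (\<Sum>k\<in>{1..n}. \<Sum>y'\<in>{1..n}. if y = y' then if g x = k then L k y' else 0 else 0)"
      using x(1) by (intro sum.cong refl) (auto simp: A_def)
    also have "\<dots> = L (g x) y"
      by (simp only: sum.delta' finite_atLeastAtMost if_True g_in[OF x(1)] x(2))
    finally show ?thesis by simp
  qed
  have "(LINT (x, y)|D. L (g x) y) =
      (LINT z|D. (\<Sum>k\<in>{1..n}. \<Sum>y\<in>{1..n}. L k y * indicator (A k \<times> {y}) z))"
    using loss by (intro Bochner_Integration.integral_cong) (auto simp: space_D)
  also have "\<dots> = (\<Sum>k\<in>{1..n}. \<Sum>y\<in>{1..n}. L k y * measure D (A k \<times> {y}))"
    by (intro has_bochner_integral_integral_eq has_bochner_integral_sum
        has_bochner_integral_mult_right has_bochner_integral_real_indicator AD)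
       (auto simp: emeasure_eq_measure)
  \<comment> \<open>The mass of each rectangle is replaced by the integral of \<open>p\<close> over
    its base.\<close>
  also have "\<dots> = (\<Sum>k\<in>{1..n}. \<Sum>y\<in>{1..n}. L k y * (LINT x|marg. indicator (A k) x * p x y))"
    using cond_prob A
    by (intro sum.cong refl) (auto simp: label_cond_prob_def set_lebesgue_integral_def)
  also have "\<dots> = (LINT x|marg. (\<Sum>k\<in>{1..n}. \<Sum>y\<in>{1..n}. L k y * (indicator (A k) x * p x y)))"
    by (intro has_bochner_integral_integral_eq[symmetric] has_bochner_integral_sum
        has_bochner_integral_mult_right has_bochner_integral_integrable int)
  also have "\<dots> = (LINT x|marg. label_cost n p L x (g x))"
    by (intro Bochner_Integration.integral_cong) (auto simp: space_marg cost)
  finally show ?eq .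
qed

end

theorem theorem14:
  fixes M :: "'a measure"
    and n :: nat
    and D :: "('a \<times> nat) measure"
    and p :: "'a \<Rightarrow> nat \<Rightarrow> real"
    and H :: "('a \<Rightarrow> nat \<Rightarrow> real) set"
    and l2 :: "('a \<Rightarrow> nat \<Rightarrow> real) \<Rightarrow> 'a \<Rightarrow> nat \<Rightarrow> real"
  assumes "prob_space D"
    and "sets D = sets (example_space M n)"
    and "label_cond_prob M n D p"
    and "H \<subseteq> all_hypotheses M n"
    and "discrete_loss M n l2"
    and "\<And>x. x \<in> space M \<Longrightarrow> predicted_labels n H x = {1..n}"
  shows "pointwise_infima_diff M n D p l2 H = 0
    \<and> minimizability_gap M n D p l2 H = approximation_error M n D l2 H"
proof -
  interpret labelled_distribution M n D p
    using assms(1-3) by (intro labelled_distribution.intro labelled_distribution_axioms.intro)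
  let ?all = "all_hypotheses M n"
  obtain L where L: "\<And>h x y. h \<in> ?all \<Longrightarrow> x \<in> space M \<Longrightarrow> y \<in> {1..n} \<Longrightarrow>
      l2 h x y = L (predicted_label n h x) y"
    using assms(5) unfolding discrete_loss_def by blast
  let ?c = "label_cost n p L"
  have cond: "cond_error n p l2 h x = ?c x (predicted_label n h x)"
    if "h \<in> ?all" "x \<in> space M" for h x
    using L[OF that] by (simp add: cond_error_def label_cost_def)
  have labels_all: "predicted_labels n ?all x = {1..n}" if x: "x \<in> space M" for x
  proof
    show "predicted_labels n ?all x \<subseteq> {1..n}"
      using predicted_label_in[OF n_pos] by (auto simp: predicted_labels_def simp del: atLeastAtMost_iff)
    have "predicted_labels n H x \<subseteq> predicted_labels n ?all x"
      using assms(4) by (auto simp: predicted_labels_def)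
    with assms(6)[OF x] show "{1..n} \<subseteq> predicted_labels n ?all x" by simp
  qed
  have best_H: "best_cond_error n p l2 H x = Inf (?c x ` {1..n})" if x: "x \<in> space M" for x
    using best_cond_error_eq[of H n p l2 x L] cond assms(4) assms(6)[OF x] x by auto
  have best_all: "best_cond_error n p l2 ?all x = Inf (?c x ` {1..n})" if x: "x \<in> space M" for x
    using best_cond_error_eq[of ?all n p l2 x L] cond labels_all[OF x] x by auto

  \<comment> \<open>The Bayes classifier: a label of maximal score is one of minimal conditional
    cost. How ties are broken does not matter, as tied labels cost the same.\<close>
  define b where "b x k = - ?c x k" for x k
  have b_all: "b \<in> ?all"
  proof (rule all_hypothesesI)
    fix k
    have "(\<lambda>x. p x y) \<in> borel_measurable M" if "y \<in> {1..n}" for y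
      using assms(3) that by (auto simp: label_cond_prob_def)
    then show "(\<lambda>x. b x k) \<in> borel_measurable M"
      unfolding b_def label_cost_def
      by (intro borel_measurable_uminus borel_measurable_sum borel_measurable_times) auto
  qed
  have b_le: "?c x (predicted_label n b x) \<le> ?c x k" if "k \<in> {1..n}" for x k
    using predicted_label_ge[OF that, of b x] by (simp add: b_def)
  have inf_b: "Inf (?c x ` {1..n}) = ?c x (predicted_label n b x)" for x
  proof (rule cInf_eq_minimum)
    show "?c x (predicted_label n b x) \<in> ?c x ` {1..n}"
      by (rule imageI) (rule predicted_label_in[OF n_pos])
  qed (auto intro: b_le)

  have err: "gen_error D l2 h = (LINT x|marg. ?c x (predicted_label n h x))"
    and int: "integrable marg (\<lambda>x. ?c x (predicted_label n h x))" if h: "h \<in> ?all" for h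
  proof -
    note g = predicted_label_measurable[OF h] predicted_label_in[OF n_pos]
    have "gen_error D l2 h = (LINT (x, y)|D. L (predicted_label n h x) y)"
      unfolding gen_error_def
      by (intro Bochner_Integration.integral_cong) (auto simp: space_D L[OF h])
    then show "gen_error D l2 h = (LINT x|marg. ?c x (predicted_label n h x))"
      using integral_label_cost[OF g] by simp
    show "integrable marg (\<lambda>x. ?c x (predicted_label n h x))"
      by (rule integrable_label_cost[OF g])
  qed
  \<comment> \<open>Optimality of \<open>b\<close> at every point integrates to optimality of its
    error, so the infimum over all measurable hypotheses is attained.\<close>
  have "gen_error D l2 b \<le> gen_error D l2 h" if h: "h \<in> ?all" for h
    unfolding err[OF h] err[OF b_all]
    by (intro integral_mono int h b_all b_le predicted_label_in n_pos)
  then have "best_error D l2 ?all = gen_error D l2 b"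
    unfolding best_error_def using b_all by (intro cInf_eq_minimum) auto
  \<comment> \<open>The pointwise infimum is taken over \<open>H\<close> itself, where it equals the
    minimum over all labels. Both gaps start from \<open>best_error D l2 H\<close>, so they agree
    once the subtracted terms do.\<close>
  also have "\<dots> = (LINT x|marg. best_cond_error n p l2 H x)"
    unfolding err[OF b_all]
    by (intro Bochner_Integration.integral_cong) (simp_all only: space_marg best_H inf_b)
  finally have "minimizability_gap M n D p l2 H = approximation_error M n D l2 H"
    by (simp add: minimizability_gap_def approximation_error_def)
  moreover have "pointwise_infima_diff M n D p l2 H = (LINT x|marg. 0)"
    unfolding pointwise_infima_diff_def
    by (intro Bochner_Integration.integral_cong) (auto simp: space_marg best_H best_all)
  ultimately show ?thesis by simp
qed

end
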